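(* Fix an interval $J\subseteq\mathbb R$, $t_0\in J$, $y\in V$ and $X\in\mathcal C^\gamma(J,V)$. If $\gamma>1/2$ and $\varphi\in C^{\delta}(V,V\otimes V^* )$ with $\delta\in(0,1)$ and $(1+\delta)\gamma>1$, there exists a path $Y\in\mathcal C^\gamma(J,V)$ which solves the differential equation $$dY^\mu_t=\varphi(Y_t)^\mu_\nu\,dX^\nu_t,\qquad Y_{t_0}=y,$$ in $J$, i.e. such that $$Y^\mu_t=y^\mu+\int_{t_0}^t\varphi(Y_u)^\mu_\nu\,dX^\nu_u\qquad\text{for every }t\in J,$$ where the integral is the Young integral.
   Context: $V$ is a finite-dimensional vector space; repeated indices are summed. $C^\delta(V,U)$ is the space of $\delta$-Hölder maps $\varphi:V\to U$, with norm $\|\varphi\|_{0,\delta}=\sup_V|\varphi|+\sup_{x\ne y}|\varphi(x)-\varphi(y)|/|x-y|^\delta$. $\mathcal C^\gamma(J,U)$ is the space of bounded continuous $f:J\to U$ with $\|f\|_{\gamma,J}:=\sup_{s\neq t\in J}|f_t-f_s|/|t-s|^\gamma<\infty$. $\Omega\mathcal C_n(J)$ is the space of bounded continuous functions $J^{n+1}\to\mathbb R$ which are zero when all arguments are equal, and $\Omega\mathcal C(J)=\Omega\mathcal C_1(J)$; for $z>0$, $\Omega\mathcal C^z(J)$ is the subspace of $R\in\Omega\mathcal C(J)$ with $\sup_{s\ne t}|R_{st}|/|t-s|^z<\infty$. For $R\in\Omega\mathcal C(J)$, $(NR)_{sut}:=R_{st}-R_{ut}-R_{su}$. For paths, $(\delta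 G)_{st}=G_t-G_s$ and $(F\,\delta G)_{st}=F_s(G_t-G_s)$. Young integral: for real-valued $F\in\mathcal C^\rho(J)$, $G\in\mathcal C^{\gamma}(J)$ with $\rho+\gamma>1$, $\int_s^tF_u\,dG_u:=[F\,\delta G-\Lambda N(F\,\delta G)]_{st}$, where $\Lambda N(F\,\delta G)$ is the unique $R\in\Omega\mathcal C^{\rho+\gamma}(J)$ with $NR=N(F\,\delta G)$, that is $(NR)_{sut}=-(F_u-F_s)(G_t-G_u)$. Here it is applied componentwise with $F=\varphi(Y)^\mu_\nu\in\mathcal C^{\delta\gamma}(J)$ and $G=X^\nu$.
   Formalization: For unbounded J the claim fails (Y may be unbounded), so the formal theorem gives one path Y on J that is in C^γ(I,V) and solves the equation, with the Young integral on I, for every bounded subinterval I of J containing t_0; for bounded J, I = J gives the claim. V has dimension at least 1. *)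

theory Defs
  imports "HOL-Analysis.Analysis"
begin

text \<open>The same space is used for paths on an interval and for vector fields on \<open>UNIV\<close>.\<close>

definition holder_space :: "real \<Rightarrow> 'a::metric_space set \<Rightarrow> ('a \<Rightarrow> 'b::real_normed_vector) set" where
  "holder_space \<gamma> S =
     {f. continuous_on S f \<and> bounded (f ` S) \<and>
         bdd_above {norm (f t - f s) / dist s t powr \<gamma> | s t. s \<in> S \<and> t \<in> S \<and> s \<noteq> t}}"

definition OmegaC :: "real set \<Rightarrow> (real \<times> real \<Rightarrow> real) set" where
  "OmegaC J =
     {R. continuous_on (J \<times> J) R \<and> bounded (R ` (J \<times> J)) \<and> (\<forall>t\<in>J. R (t, t) = 0)}"

definition OmegaC_exp :: "real \<Rightarrow> real set \<Rightarrow> (real \<times> real \<Rightarrow> real) set" where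
  "OmegaC_exp z J =
     {R \<in> OmegaC J. bdd_above {\<bar>R (s, t)\<bar> / \<bar>t - s\<bar> powr z | s t. s \<in> J \<and> t \<in> J \<and> s \<noteq> t}}"

definition N_op :: "(real \<times> real \<Rightarrow> real) \<Rightarrow> real \<Rightarrow> real \<Rightarrow> real \<Rightarrow> real" where
  "N_op R s u t = R (s, t) - R (u, t) - R (s, u)"

definition path_incr :: "(real \<Rightarrow> real) \<Rightarrow> (real \<Rightarrow> real) \<Rightarrow> real \<times> real \<Rightarrow> real" where
  "path_incr F G = (\<lambda>(s, t). F s * (G t - G s))"

text \<open>\<open>Lambda_N z J A\<close> is \<open>\<Lambda>NA\<close>, the unique \<open>R\<close> of order \<open>z\<close> with \<open>NR = NA\<close> on \<open>J\<close>.
  Membership in \<open>extensional\<close> fixes the values outside \<open>J \<times> J\<close>, which would otherwise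
  make the description ambiguous.\<close>

definition Lambda_N :: "real \<Rightarrow> real set \<Rightarrow> (real \<times> real \<Rightarrow> real) \<Rightarrow> real \<times> real \<Rightarrow> real" where
  "Lambda_N z J A =
     (THE R. R \<in> OmegaC_exp z J \<and> R \<in> extensional (J \<times> J) \<and>
             (\<forall>s\<in>J. \<forall>u\<in>J. \<forall>t\<in>J. N_op R s u t = N_op A s u t))"

text \<open>Meaningful for \<open>F \<in> holder_space \<rho> J\<close>, \<open>G \<in> holder_space \<gamma> J\<close>, \<open>\<rho> + \<gamma> > 1\<close>
  and \<open>J\<close> a bounded interval. On an unbounded \<open>J\<close> a remainder that is bounded, as
  \<open>OmegaC J\<close> demands, need not exist.\<close>

definition young_integral ::
  "real \<Rightarrow> real \<Rightarrow> real set \<Rightarrow> (real \<Rightarrow> real) \<Rightarrow> (real \<Rightarrow> real) \<Rightarrow> real \<Rightarrow> real \<Rightarrow> real" where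
  "young_integral \<rho> \<gamma> J F G s t =
     path_incr F G (s, t) - Lambda_N (\<rho> + \<gamma>) J (path_incr F G) (s, t)"

end

theory Submission
  imports Defs
begin

text \<open>Write \<open>z = \<delta> * \<gamma> + \<gamma>\<close>, which exceeds \<open>1\<close>. Following Davie, a path \<open>Y\<close> solves the equation as soon as
the one-step error of the Euler scheme, \<open>Y\<^sub>t - Y\<^sub>s - \<phi>(Y\<^sub>s) (X\<^sub>t - X\<^sub>s)\<close>, is
\<open>O(\<bar>t - s\<bar>\<^sup>z)\<close>. Indeed the increments of the Young integral have the same expansion, so the
difference between both increments is additive in \<open>(s, t)\<close> and of order \<open>z > 1\<close>; it has zero
derivative and vanishes (\<open>additive_superlinear_eq_0\<close>, used in \<open>young_integral_eqI\<close>).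

Such a \<open>Y\<close> is found by compactness. On every finite set of times the Euler scheme exists, and
\<open>euler_defect_bound\<close> bounds its one-step error over any two grid times by
\<open>K \<bar>t - s\<bar>\<^sup>z\<close>, where \<open>K\<close> depends on the length of time considered but not on the grid. The proof
is an induction on the number of grid points between \<open>s\<close> and \<open>t\<close>. Cutting \<open>[s, t]\<close> at its midpoint
multiplies the bound by \<open>2 * (1/2)\<^sup>z < 1\<close> and adds an error which grows with \<open>K\<close> only like
\<open>K\<^sup>\<delta>\<close>; since \<open>\<delta> < 1\<close>, a large \<open>K\<close> reproduces itself. The error bound at a fixed pair of times
is a closed condition on \<open>Y\<close> in the topology of pointwise convergence, as the field is continuous, and the scheme stays in
a product of balls, which is compact by Tychonoff's theorem. The finite intersection property then
gives one path that satisfies the bound at all pairs of times at once (\<open>solution_from_left_end\<close>).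
The scheme runs forward from the
initial time, so times before \<open>t0\<close> are treated by time reversal and both halves are glued.

The equation is studied with a field \<open>f\<close> that may also depend on time, in a Hoelder way with
exponent \<open>\<delta> * \<gamma>\<close>. The autonomous field \<open>\<phi>\<close> is one special case; the field \<open>f s w = F s\<close> is
another, and its solution is a primitive \<open>W\<close> for which
\<open>F\<^sub>s (G\<^sub>t - G\<^sub>s) - (W\<^sub>t - W\<^sub>s)\<close> is the remainder \<open>\<Lambda>N(F \<delta>G)\<close>. Thus the existence of the
Young integral and that of the solution come from the same argument.\<close>

section \<open>Euler schemes and their one-step error\<close>

definition young_defect ::
  "(real \<Rightarrow> 'v::real_normed_vector) \<Rightarrow> (real \<Rightarrow> 'w \<Rightarrow> ('v \<Rightarrow>\<^sub>L 'w)) \<Rightarrow> (real \<Rightarrow> 'w) \<Rightarrow> real \<Rightarrow> real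
    \<Rightarrow> 'w::real_normed_vector" where
  "young_defect X f Y s t = Y t - Y s - blinfun_apply (f s (Y s)) (X t - X s)"

text \<open>The constant is allowed to depend on the length \<open>H\<close> of time, because the estimates on the Euler
scheme are uniform in the position of \<open>s\<close> and \<open>t\<close> but not in their distance.\<close>

definition young_solution ::
  "real \<Rightarrow> (real \<Rightarrow> 'v::real_normed_vector) \<Rightarrow> (real \<Rightarrow> 'w \<Rightarrow> ('v \<Rightarrow>\<^sub>L 'w)) \<Rightarrow> real set
    \<Rightarrow> (real \<Rightarrow> 'w::real_normed_vector) \<Rightarrow> bool" where
  "young_solution z X f S Y \<longleftrightarrow>
     (\<forall>H. \<exists>K\<ge>0. \<forall>s\<in>S. \<forall>t\<in>S. \<bar>t - s\<bar> \<le> H \<longrightarrow> norm (young_defect X f Y s t) \<le> K * \<bar>t - s\<bar> powr z)"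

definition euler_scheme ::
  "(real \<Rightarrow> 'v::real_normed_vector) \<Rightarrow> (real \<Rightarrow> 'w \<Rightarrow> ('v \<Rightarrow>\<^sub>L 'w)) \<Rightarrow> real set
    \<Rightarrow> (real \<Rightarrow> 'w::real_normed_vector) \<Rightarrow> bool" where
  "euler_scheme X f P Y \<longleftrightarrow>
     (\<forall>a\<in>P. \<forall>b\<in>P. a < b \<and> P \<inter> {a<..<b} = {} \<longrightarrow> young_defect X f Y a b = 0)"

lemma young_defect_same [simp]: "young_defect X f Y s s = 0"
  by (simp add: young_defect_def)

text \<open>One step from \<open>s\<close> to \<open>t\<close> and two steps through \<open>u\<close> differ only because the second of the two steps
uses the field at \<open>u\<close> instead of the field at \<open>s\<close>.\<close>

lemma young_defect_split:
  "young_defect X f Y s t =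
     young_defect X f Y s u + young_defect X f Y u t
     + blinfun_apply (f u (Y u) - f s (Y s)) (X t - X u)"
  by (simp add: young_defect_def blinfun.diff_left blinfun.diff_right)

text \<open>The first clause fixes two things together: the value at the least grid time is the initial value,
and off the grid the path is constantly \<open>w\<close>, so that it lies in every ball around \<open>w\<close>.\<close>

lemma euler_scheme_exists:
  fixes X :: "real \<Rightarrow> 'v::real_normed_vector"
    and f :: "real \<Rightarrow> 'w::real_normed_vector \<Rightarrow> ('v \<Rightarrow>\<^sub>L 'w)"
  assumes "finite P"
  shows "\<exists>Y. (\<forall>p. (p \<in> P \<longrightarrow> (\<forall>q\<in>P. p \<le> q)) \<longrightarrow> Y p = w) \<and> euler_scheme X f P Y"
  using assms
proof (induction rule: finite_linorder_max_induct)
  case empty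
  show ?case by (auto simp: euler_scheme_def intro!: exI[of _ "\<lambda>_. w"])
next
  case (insert b P)
  from insert.IH obtain Y
    where Y0: "\<forall>p. (p \<in> P \<longrightarrow> (\<forall>q\<in>P. p \<le> q)) \<longrightarrow> Y p = w" "euler_scheme X f P Y"
    by (elim exE conjE)
  note Y = Y0(1)[rule_format] Y0(2)
  show ?case
  proof (cases "P = {}")
    case True
    then show ?thesis by (auto simp: euler_scheme_def intro!: exI[of _ "\<lambda>_. w"])
  next
    case False
    define a where "a = Max P"
    have a: "a \<in> P" "\<And>p. p \<in> P \<Longrightarrow> p \<le> a" "a < b"
      using insert False by (auto simp: a_def)
    define Y' where "Y' = Y(b := Y a + blinfun_apply (f a (Y a)) (X b - X a))"
    have bP: "b \<notin> P" using insert.hyps(2) by blast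
    have "Y' p = w" if p: "p \<in> insert b P \<longrightarrow> (\<forall>q\<in>insert b P. p \<le> q)" for p
    proof -
      have "p \<noteq> b" using p a by force
      then show ?thesis using p Y(1)[of p] by (auto simp: Y'_def)
    qed
    moreover have "young_defect X f Y' c d = 0"
      if cd: "c \<in> insert b P" "d \<in> insert b P" "c < d" "insert b P \<inter> {c<..<d} = {}" for c d
    proof (cases "d = b")
      case True
      then have "c \<in> P" using cd by auto
      moreover have "\<not> c < a" using cd True a by auto
      ultimately have "c = a" using a(2) by force
      then show ?thesis using True a by (simp add: young_defect_def Y'_def)
    next
      case False
      then have "d \<in> P" "c \<in> P" using cd insert.hyps(2) by force+
      moreover have "c \<noteq> b" "d \<noteq> b" using calculation bP by auto
      ultimately show ?thesis using Y(2) cd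
        by (auto simp: euler_scheme_def young_defect_def Y'_def)
    qed
    ultimately show ?thesis unfolding euler_scheme_def by blast
  qed
qed

section \<open>The equation driven by a Hoelder path\<close>

locale young_equation =
  fixes J :: "real set"
    and X :: "real \<Rightarrow> 'v::real_normed_vector"
    and f :: "real \<Rightarrow> 'w::euclidean_space \<Rightarrow> ('v \<Rightarrow>\<^sub>L 'w)"
    and \<gamma> \<delta> L C M :: real
  assumes \<gamma>_pos: "0 < \<gamma>"
    and \<delta>_pos: "0 < \<delta>" and \<delta>_less: "\<delta> < 1"
    and young: "\<delta> * \<gamma> + \<gamma> > 1"
    and L_nonneg: "0 \<le> L" and C_nonneg: "0 \<le> C" and M_nonneg: "0 \<le> M"
    and driver_holder: "\<And>s t. s \<in> J \<Longrightarrow> t \<in> J \<Longrightarrow> norm (X t - X s) \<le> L * \<bar>t - s\<bar> powr \<gamma>"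
    and field_bounded: "\<And>s w. s \<in> J \<Longrightarrow> norm (f s w) \<le> M"
    and field_holder: "\<And>s t v w. s \<in> J \<Longrightarrow> t \<in> J \<Longrightarrow>
          norm (f t w - f s v) \<le> C * (\<bar>t - s\<bar> powr (\<delta> * \<gamma>) + norm (w - v) powr \<delta>)"
begin

abbreviation z where "z \<equiv> \<delta> * \<gamma> + \<gamma>"

text \<open>This error has order \<open>\<delta> * \<gamma>\<close> from the variation of the field and order \<open>\<gamma>\<close> from the increment of
the driver. The dependence on the Hoelder constant \<open>B\<close> of \<open>Y\<close> is sublinear, which is what closes the
induction in \<open>euler_defect_bound\<close>.\<close>

lemma splitting_error:
  assumes "s \<in> J" "u \<in> J" "t \<in> J" and d: "\<bar>u - s\<bar> \<le> d" "\<bar>t - u\<bar> \<le> d"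
    and B: "0 \<le> B" "norm (Y u - Y s) \<le> B * \<bar>u - s\<bar> powr \<gamma>"
  shows "norm (blinfun_apply (f u (Y u) - f s (Y s)) (X t - X u))
           \<le> C * L * (1 + B powr \<delta>) * d powr z"
proof -
  have d0: "0 \<le> d" using d by linarith
  have "norm (Y u - Y s) \<le> B * d powr \<gamma>"
    using B d \<gamma>_pos by (meson abs_ge_zero less_imp_le mult_left_mono order_trans powr_mono2)
  then have "norm (Y u - Y s) powr \<delta> \<le> (B * d powr \<gamma>) powr \<delta>"
    using \<delta>_pos by (intro powr_mono2) auto
  also have "\<dots> = B powr \<delta> * d powr (\<delta> * \<gamma>)"
    using B by (simp add: powr_mult powr_powr mult.commute)
  finally have 1: "norm (Y u - Y s) powr \<delta> \<le> B powr \<delta> * d powr (\<delta> * \<gamma>)" .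
  have 2: "\<bar>u - s\<bar> powr (\<delta> * \<gamma>) \<le> d powr (\<delta> * \<gamma>)"
    using d \<delta>_pos \<gamma>_pos by (intro powr_mono2) auto
  have "norm (f u (Y u) - f s (Y s)) \<le> C * (\<bar>u - s\<bar> powr (\<delta> * \<gamma>) + norm (Y u - Y s) powr \<delta>)"
    using assms by (intro field_holder)
  also have "\<dots> \<le> C * (d powr (\<delta> * \<gamma>) + B powr \<delta> * d powr (\<delta> * \<gamma>))"
    using 1 2 C_nonneg by (intro mult_left_mono add_mono)
  finally have 3: "norm (f u (Y u) - f s (Y s)) \<le> C * (1 + B powr \<delta>) * d powr (\<delta> * \<gamma>)"
    by (simp add: algebra_simps)
  have "norm (X t - X u) \<le> L * \<bar>t - u\<bar> powr \<gamma>"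
    using assms by (intro driver_holder)
  also have "\<dots> \<le> L * d powr \<gamma>"
    using d \<gamma>_pos L_nonneg by (intro mult_left_mono powr_mono2) auto
  finally have 4: "norm (X t - X u) \<le> L * d powr \<gamma>" .
  have "norm (blinfun_apply (f u (Y u) - f s (Y s)) (X t - X u))
          \<le> norm (f u (Y u) - f s (Y s)) * norm (X t - X u)"
    by (rule norm_blinfun)
  also have "\<dots> \<le> (C * (1 + B powr \<delta>) * d powr (\<delta> * \<gamma>)) * (L * d powr \<gamma>)"
    using 3 4 C_nonneg by (intro mult_mono) auto
  finally show ?thesis by (simp add: powr_add algebra_simps)
qed

lemma increment_bound:
  assumes "s \<in> J" "t \<in> J" and "\<bar>t - s\<bar> \<le> H" "0 \<le> K"
    and "norm (young_defect X f Y s t) \<le> K * \<bar>t - s\<bar> powr z"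
  shows "norm (Y t - Y s) \<le> (M * L + K * H powr (\<delta> * \<gamma>)) * \<bar>t - s\<bar> powr \<gamma>"
proof -
  have "norm (blinfun_apply (f s (Y s)) (X t - X s)) \<le> norm (f s (Y s)) * norm (X t - X s)"
    by (rule norm_blinfun)
  also have "\<dots> \<le> M * (L * \<bar>t - s\<bar> powr \<gamma>)"
    using assms M_nonneg by (intro mult_mono field_bounded driver_holder) auto
  finally have 1: "norm (blinfun_apply (f s (Y s)) (X t - X s)) \<le> M * (L * \<bar>t - s\<bar> powr \<gamma>)" .
  have "\<bar>t - s\<bar> powr (\<delta> * \<gamma>) \<le> H powr (\<delta> * \<gamma>)"
    using assms \<delta>_pos \<gamma>_pos by (intro powr_mono2) auto
  then have "K * (\<bar>t - s\<bar> powr (\<delta> * \<gamma>) * \<bar>t - s\<bar> powr \<gamma>)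
      \<le> K * (H powr (\<delta> * \<gamma>) * \<bar>t - s\<bar> powr \<gamma>)"
    using assms by (intro mult_left_mono mult_right_mono) auto
  then have 2: "norm (young_defect X f Y s t) \<le> K * (H powr (\<delta> * \<gamma>) * \<bar>t - s\<bar> powr \<gamma>)"
    using assms(5) by (simp add: powr_add)
  have "Y t - Y s = young_defect X f Y s t + blinfun_apply (f s (Y s)) (X t - X s)"
    by (simp add: young_defect_def)
  then have "norm (Y t - Y s)
      \<le> norm (young_defect X f Y s t) + norm (blinfun_apply (f s (Y s)) (X t - X s))"
    by (metis norm_triangle_ineq)
  then show ?thesis using 1 2 by (simp add: algebra_simps)
qed

text \<open>As a function of \<open>K\<close> the left side is at most \<open>\<theta> * K + a * K\<^sup>\<delta>\<close> for \<open>K \<ge> 1\<close>, with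
\<open>\<theta> = 2 * (1/2)\<^sup>z < 1\<close> and \<open>\<delta> < 1\<close>. The first term is the contribution of the two halves of a
time interval in \<open>euler_defect_bound\<close>, the second that of the two splitting errors.\<close>

lemma defect_constant_exists:
  "\<exists>K\<ge>0. 2 * (1/2) powr z * K + 2 * (C * L * (1 + (M * L + K * H powr (\<delta> * \<gamma>)) powr \<delta>)) \<le> K"
proof -
  define \<theta> where "\<theta> = 2 * (1/2::real) powr z"
  define b where "b = M * L + H powr (\<delta> * \<gamma>)"
  define a where "a = 2 * C * L * (1 + b powr \<delta>)"
  \<comment> \<open>This power is the solution \<open>K\<close> of \<open>a * K powr \<delta> = (1 - \<theta>) * K\<close>.\<close>
  define K where "K = max 1 ((a / (1 - \<theta>)) powr (1 / (1 - \<delta>)))"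
  have "(1/2::real) powr z < (1/2) powr 1"
    using young by (intro powr_less_mono') auto
  then have \<theta>: "\<theta> < 1" by (simp add: \<theta>_def)
  have b0: "0 \<le> b" and inc_nonneg: "0 \<le> M * L" using M_nonneg L_nonneg by (auto simp: b_def)
  have a0: "0 \<le> a" using C_nonneg L_nonneg by (auto simp: a_def)
  have K1: "1 \<le> K" by (simp add: K_def)
  have "a / (1 - \<theta>) = ((a / (1 - \<theta>)) powr (1 / (1 - \<delta>))) powr (1 - \<delta>)"
    using a0 \<theta> \<delta>_less by (simp add: powr_powr)
  also have "\<dots> \<le> K powr (1 - \<delta>)"
    using \<delta>_less by (intro powr_mono2) (auto simp: K_def)
  finally have "a \<le> (1 - \<theta>) * K powr (1 - \<delta>)"
    using \<theta> by (simp add: field_simps)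
  then have "a * K powr \<delta> \<le> (1 - \<theta>) * K powr (1 - \<delta>) * K powr \<delta>"
    by (intro mult_right_mono) auto
  also have "\<dots> = (1 - \<theta>) * K"
    using K1 by (simp add: powr_add[symmetric] mult.assoc)
  finally have 1: "a * K powr \<delta> \<le> (1 - \<theta>) * K" .
  have "M * L + K * H powr (\<delta> * \<gamma>) \<le> K * b"
    using mult_right_mono[OF K1 inc_nonneg] by (simp add: b_def algebra_simps)
  then have "(M * L + K * H powr (\<delta> * \<gamma>)) powr \<delta> \<le> (K * b) powr \<delta>"
    using \<delta>_pos inc_nonneg K1 by (intro powr_mono2) auto
  also have "\<dots> = K powr \<delta> * b powr \<delta>" using K1 b0 by (simp add: powr_mult)
  finally have "1 + (M * L + K * H powr (\<delta> * \<gamma>)) powr \<delta> \<le> K powr \<delta> * (1 + b powr \<delta>)"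
    using ge_one_powr_ge_zero[OF K1, of \<delta>] \<delta>_pos by (simp add: algebra_simps)
  then have "C * L * (1 + (M * L + K * H powr (\<delta> * \<gamma>)) powr \<delta>)
      \<le> C * L * (K powr \<delta> * (1 + b powr \<delta>))"
    using C_nonneg L_nonneg by (intro mult_left_mono) auto
  then have "2 * (C * L * (1 + (M * L + K * H powr (\<delta> * \<gamma>)) powr \<delta>)) \<le> a * K powr \<delta>"
    by (simp add: a_def algebra_simps)
  with 1 have "\<theta> * K + 2 * (C * L * (1 + (M * L + K * H powr (\<delta> * \<gamma>)) powr \<delta>)) \<le> K"
    by (simp add: algebra_simps)
  then show ?thesis using K1 unfolding \<theta>_def by (intro exI[of _ K]) auto
qed

text \<open>Let \<open>m\<close> and \<open>m'\<close> be the neighbouring grid times on both sides of the midpoint of \<open>[s, t]\<close>. The step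
from \<open>m\<close> to \<open>m'\<close> has no error by construction, and the intervals \<open>[s, m]\<close> and \<open>[m', t]\<close> have at
most half the length of \<open>[s, t]\<close>, however irregular the grid is.\<close>

lemma euler_defect_bound:
  assumes P: "finite P" "P \<subseteq> J" "euler_scheme X f P Y"
    and K: "0 \<le> K"
      "2 * (1/2) powr z * K + 2 * (C * L * (1 + (M * L + K * H powr (\<delta> * \<gamma>)) powr \<delta>)) \<le> K"
    and "s \<in> P" "t \<in> P" "s \<le> t" "t - s \<le> H"
  shows "norm (young_defect X f Y s t) \<le> K * (t - s) powr z"
  using assms(6-9)
proof (induction "card (P \<inter> {s..t})" arbitrary: s t rule: less_induct)
  case less
  define B where "B = M * L + K * H powr (\<delta> * \<gamma>)"
  have B0: "0 \<le> B" using M_nonneg L_nonneg K by (simp add: B_def)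
  show ?case
  proof (cases "s = t \<or> P \<inter> {s<..<t} = {}")
    case True
    then have "young_defect X f Y s t = 0"
      using less.prems P(3) by (cases "s = t") (auto simp: euler_scheme_def)
    then show ?thesis using K by simp
  next
    case False
    then have st: "s < t" using less.prems by simp
    define c where "c = (s + t) / 2"
    define m where "m = Max (P \<inter> {s..c})"
    define m' where "m' = Min (P \<inter> {c<..t})"
    have "s \<in> P \<inter> {s..c}" using less.prems st by (auto simp: c_def)
    then have m: "m \<in> P \<inter> {s..c}" "\<And>p. p \<in> P \<inter> {s..c} \<Longrightarrow> p \<le> m"
      unfolding m_def using P(1) by (auto intro!: Max_in Max_ge simp del: Int_iff)
    have "t \<in> P \<inter> {c<..t}" using less.prems st by (auto simp: c_def)
    then have m': "m' \<in> P \<inter> {c<..t}" "\<And>p. p \<in> P \<inter> {c<..t} \<Longrightarrow> m' \<le> p"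
      unfolding m'_def using P(1) by (auto intro!: Min_in Min_le simp del: Int_iff)
    have mm: "s \<le> m" "m \<le> c" "c < m'" "m' \<le> t" "m \<in> P" "m' \<in> P" using m m' by auto
    have gap: "P \<inter> {m<..<m'} = {}"
    proof (rule ccontr)
      assume "P \<inter> {m<..<m'} \<noteq> {}"
      then obtain p where p: "p \<in> P" "m < p" "p < m'" by auto
      show False using m(2)[of p] m'(2)[of p] p mm by (cases "p \<le> c") auto
    qed
    have half: "m - s \<le> (t - s) / 2" "t - m' \<le> (t - s) / 2"
      using mm by (auto simp: c_def)
    have J: "s \<in> J" "m \<in> J" "m' \<in> J" "t \<in> J" using mm less.prems P by auto
    have left: "norm (young_defect X f Y s m) \<le> K * (m - s) powr z"
    proof (rule less.hyps)
      have "t \<notin> P \<inter> {s..m}" "t \<in> P \<inter> {s..t}" using mm st less.prems by (auto simp: c_def)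
      moreover have "P \<inter> {s..m} \<subseteq> P \<inter> {s..t}" using mm by auto
      ultimately show "card (P \<inter> {s..m}) < card (P \<inter> {s..t})"
        using P(1) by (intro psubset_card_mono) auto
    qed (use mm less.prems in auto)
    have right: "norm (young_defect X f Y m' t) \<le> K * (t - m') powr z"
    proof (rule less.hyps)
      have "s \<notin> P \<inter> {m'..t}" "s \<in> P \<inter> {s..t}" using mm st less.prems by (auto simp: c_def)
      moreover have "P \<inter> {m'..t} \<subseteq> P \<inter> {s..t}" using mm by auto
      ultimately show "card (P \<inter> {m'..t}) < card (P \<inter> {s..t})"
        using P(1) by (intro psubset_card_mono) auto
    qed (use mm less.prems in auto)
    have mid: "young_defect X f Y m m' = 0"
      using P(3) mm gap by (auto simp: euler_scheme_def)
    \<comment> \<open>On either half the induction hypothesis gains the factor \<open>(1/2) powr z\<close>.\<close>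
    have halfK: "K * e powr z \<le> K * (1/2) powr z * (t - s) powr z"
      if "0 \<le> e" "e \<le> (t - s) / 2" for e
    proof -
      have "e powr z \<le> (1/2 * (t - s)) powr z" using that young by (intro powr_mono2) auto
      also have "\<dots> = (1/2) powr z * (t - s) powr z" using st by (subst powr_mult) auto
      finally show ?thesis using K by (simp add: mult_left_mono mult.assoc)
    qed
    have inc1: "norm (Y m - Y s) \<le> B * \<bar>m - s\<bar> powr \<gamma>"
      unfolding B_def using left mm less.prems K J by (intro increment_bound) auto
    have inc2: "norm (Y m' - Y m) \<le> B * \<bar>m' - m\<bar> powr \<gamma>"
      unfolding B_def using mid mm less.prems K J by (intro increment_bound) auto
    have err1: "norm (blinfun_apply (f m (Y m) - f s (Y s)) (X t - X m))
        \<le> C * L * (1 + B powr \<delta>) * (t - s) powr z"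
      using mm J inc1 B0 by (intro splitting_error) auto
    have err2: "norm (blinfun_apply (f m' (Y m') - f m (Y m)) (X t - X m'))
        \<le> C * L * (1 + B powr \<delta>) * (t - s) powr z"
      using mm J inc2 B0 by (intro splitting_error) auto
    have "young_defect X f Y s t = young_defect X f Y s m + young_defect X f Y m' t
        + blinfun_apply (f m (Y m) - f s (Y s)) (X t - X m)
        + blinfun_apply (f m' (Y m') - f m (Y m)) (X t - X m')"
      using young_defect_split[of X f Y s t m] young_defect_split[of X f Y m t m'] mid by simp
    then have "norm (young_defect X f Y s t)
        \<le> norm (young_defect X f Y s m) + norm (young_defect X f Y m' t)
        + norm (blinfun_apply (f m (Y m) - f s (Y s)) (X t - X m))
        + norm (blinfun_apply (f m' (Y m') - f m (Y m)) (X t - X m'))"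
      by (metis norm_triangle_le add_mono order_refl norm_triangle_ineq)
    also have "\<dots> \<le> (2 * (1/2) powr z * K + 2 * (C * L * (1 + B powr \<delta>))) * (t - s) powr z"
      using left right err1 err2 halfK[of "m - s"] halfK[of "t - m'"] half mm
      by (simp add: algebra_simps)
    also have "\<dots> \<le> K * (t - s) powr z"
      using K(2) unfolding B_def by (intro mult_right_mono) auto
    finally show ?thesis .
  qed
qed

lemma field_continuous:
  assumes "s \<in> J"
  shows "continuous_on UNIV (f s)"
proof -
  have "((\<lambda>w. f s w) \<longlongrightarrow> f s v) (at v)" for v
  proof -
    have "((\<lambda>w. C * norm (w - v) powr \<delta>) \<longlongrightarrow> C * norm (v - v) powr \<delta>) (at v)"
      using \<delta>_pos by (intro tendsto_intros) auto
    then have "((\<lambda>w. C * norm (w - v) powr \<delta>) \<longlongrightarrow> 0) (at v)" by simp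
    moreover have "norm (f s w - f s v) \<le> C * norm (w - v) powr \<delta>" for w
      using field_holder[OF assms assms, of w v] by simp
    ultimately have "((\<lambda>w. f s w - f s v) \<longlongrightarrow> 0) (at v)"
      by (intro Lim_null_comparison[of "\<lambda>w. f s w - f s v"]) auto
    then show ?thesis by (simp add: LIM_zero_iff)
  qed
  then show ?thesis by (simp add: continuous_on_def)
qed

text \<open>The Euler step evaluates the field at its starting time, so the error from \<open>s\<close> to \<open>t\<close> is not the
negative of the error from \<open>t\<close> to \<open>s\<close>. Going forth and back splits the trivial step from \<open>t\<close> to \<open>t\<close>
and shows that the discrepancy is a splitting error.\<close>

lemma ordered_imp_young_solution:
  assumes S: "S \<subseteq> J"
    and fwd: "\<And>H. \<exists>K\<ge>0. \<forall>s\<in>S. \<forall>t\<in>S. s \<le> t \<and> t - s \<le> H \<longrightarrow>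
                norm (young_defect X f Y s t) \<le> K * (t - s) powr z"
  shows "young_solution z X f S Y"
  unfolding young_solution_def
proof
  fix H
  obtain K where K: "0 \<le> K" "\<And>s t. s \<in> S \<Longrightarrow> t \<in> S \<Longrightarrow> s \<le> t \<Longrightarrow> t - s \<le> H \<Longrightarrow>
                norm (young_defect X f Y s t) \<le> K * (t - s) powr z"
    using fwd[of H] by blast
  define B where "B = M * L + K * H powr (\<delta> * \<gamma>)"
  have B0: "0 \<le> B" using M_nonneg L_nonneg K by (simp add: B_def)
  define K' where "K' = K + C * L * (1 + B powr \<delta>)"
  have "K \<le> K'" using C_nonneg L_nonneg by (simp add: K'_def)
  have "norm (young_defect X f Y s t) \<le> K' * \<bar>t - s\<bar> powr z"
    if st: "s \<in> S" "t \<in> S" "\<bar>t - s\<bar> \<le> H" for s t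
  proof (cases "s \<le> t")
    case True
    then have "norm (young_defect X f Y s t) \<le> K * \<bar>t - s\<bar> powr z" using K(2)[of s t] st by simp
    also have "\<dots> \<le> K' * \<bar>t - s\<bar> powr z" using \<open>K \<le> K'\<close> by (intro mult_right_mono) auto
    finally show ?thesis .
  next
    case False
    then have 1: "norm (young_defect X f Y t s) \<le> K * \<bar>t - s\<bar> powr z"
      using K(2)[of t s] st by simp
    have "norm (Y s - Y t) \<le> B * \<bar>s - t\<bar> powr \<gamma>"
      unfolding B_def using 1 K st S by (intro increment_bound) (auto simp: abs_minus_commute)
    then have 2: "norm (blinfun_apply (f s (Y s) - f t (Y t)) (X t - X s))
        \<le> C * L * (1 + B powr \<delta>) * \<bar>t - s\<bar> powr z"
      using B0 st S by (intro splitting_error) (auto simp: abs_minus_commute)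
    have "young_defect X f Y s t =
        - (young_defect X f Y t s + blinfun_apply (f s (Y s) - f t (Y t)) (X t - X s))"
      using young_defect_split[of X f Y t t s] by (simp add: eq_neg_iff_add_eq_0 algebra_simps)
    then have "norm (young_defect X f Y s t) \<le> norm (young_defect X f Y t s)
        + norm (blinfun_apply (f s (Y s) - f t (Y t)) (X t - X s))"
      by (metis norm_minus_cancel norm_triangle_ineq)
    then show ?thesis using 1 2 by (simp add: K'_def algebra_simps)
  qed
  then show "\<exists>K\<ge>0. \<forall>s\<in>S. \<forall>t\<in>S. \<bar>t - s\<bar> \<le> H \<longrightarrow>
      norm (young_defect X f Y s t) \<le> K * \<bar>t - s\<bar> powr z"
    using K(1) \<open>K \<le> K'\<close> by (intro exI[of _ K']) auto
qed

text \<open>The forward scheme determines the path from its value at the least time, whence the restriction on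
\<open>t0\<close>. The compact set consists of the paths with values in balls around \<open>w\<close> whose radii \<open>R t\<close> are
the growth that the error bound permits. The family of closed conditions is indexed by triples
\<open>(H, s, t)\<close>; finitely many of them involve finitely many times, and the Euler scheme on these times
together with \<open>t0\<close> satisfies them all.\<close>

lemma solution_from_left_end:
  assumes t0: "t0 \<in> J" "\<And>t. t \<in> J \<Longrightarrow> t0 \<le> t"
  shows "\<exists>Y. Y t0 = w \<and> young_solution z X f J Y"
proof -
  obtain K where K: "\<And>H. 0 \<le> K H"
    "\<And>H. 2 * (1/2) powr z * K H
        + 2 * (C * L * (1 + (M * L + K H * H powr (\<delta> * \<gamma>)) powr \<delta>)) \<le> K H"
    using defect_constant_exists by metis
  define R where "R t = (if t \<in> J then (M * L + K (t - t0) * (t - t0) powr (\<delta> * \<gamma>)) * (t - t0) powr \<gamma> else 0)" for t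
  have R0: "0 \<le> R t" for t using M_nonneg L_nonneg K(1) by (simp add: R_def)
  define E where "E = (\<lambda>(H, s, t). {Y. norm (young_defect X f Y s t) \<le> K H * (t - s) powr z})"
  define T where "T = {(H, s, t). s \<in> J \<and> t \<in> J \<and> s \<le> t \<and> t - s \<le> H}"
  have coord: "continuous_on A (\<lambda>Y. Y t)" for A :: "(real \<Rightarrow> 'w) set" and t :: real
    by (rule continuous_on_subset[OF continuous_on_product_coordinates]) simp
  have closed_E: "closed (E i)" if "i \<in> T" for i
  proof -
    obtain H s t where i: "i = (H, s, t)" by (cases i)
    then have "s \<in> J" using that by (simp add: T_def)
    have "continuous_on UNIV (\<lambda>Y. f s (Y s))"
      using continuous_on_compose2[OF field_continuous[OF \<open>s \<in> J\<close>] coord] by auto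
    then have "continuous_on UNIV (\<lambda>Y. young_defect X f Y s t)"
      unfolding young_defect_def by (intro continuous_intros coord)
    then show ?thesis unfolding i E_def prod.case
      by (intro closed_Collect_le continuous_intros)
  qed
  let ?B = "PiE UNIV (\<lambda>t. cball w (R t))"
  have compact_B: "compact ?B"
  proof -
    have "compactin (product_topology (\<lambda>_. euclidean) UNIV) ?B"
      by (subst compactin_PiE) auto
    then show ?thesis by (simp add: euclidean_product_topology)
  qed
  have fip: "?B \<inter> (\<Inter>i\<in>T'. E i) \<noteq> {}" if T': "finite T'" "T' \<subseteq> T" for T'
  proof -
    define P where "P = insert t0 ((\<lambda>(H, s, t). s) ` T' \<union> (\<lambda>(H, s, t). t) ` T')"
    have P: "finite P" "P \<subseteq> J" "t0 \<in> P" using T' t0 by (auto simp: P_def T_def)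
    obtain Y where Y: "\<forall>p. (p \<in> P \<longrightarrow> (\<forall>q\<in>P. p \<le> q)) \<longrightarrow> Y p = w" "euler_scheme X f P Y"
      using euler_scheme_exists[OF P(1), of w X f] by (elim exE conjE)
    have bound: "norm (young_defect X f Y s t) \<le> K H * (t - s) powr z"
      if "s \<in> P" "t \<in> P" "s \<le> t" "t - s \<le> H" for s t H
      using euler_defect_bound[OF P(1,2) Y(2) K that] .
    have "Y t0 = w" using Y(1) P t0 by blast
    have "Y t \<in> cball w (R t)" for t
    proof (cases "t \<in> P")
      case True
      then have "t \<in> J" "t0 \<le> t" using P t0 by auto
      then have "norm (Y t - Y t0) \<le> (M * L + K (t - t0) * (t - t0) powr (\<delta> * \<gamma>)) * \<bar>t - t0\<bar> powr \<gamma>"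
        using bound[of t0 t "t - t0"] P True K t0 by (intro increment_bound) auto
      then show ?thesis using \<open>t \<in> J\<close> \<open>t0 \<le> t\<close> \<open>Y t0 = w\<close>
        by (simp add: R_def dist_norm norm_minus_commute)
    next
      case False
      then show ?thesis using spec[OF Y(1), of t] False R0 by simp
    qed
    then have "Y \<in> ?B" by auto
    moreover have "Y \<in> E i" if "i \<in> T'" for i
    proof -
      obtain H s t where i: "i = (H, s, t)" by (cases i)
      have "s \<in> (\<lambda>(H, s, t). s) ` T'" "t \<in> (\<lambda>(H, s, t). t) ` T'"
        by (rule rev_image_eqI[OF that], simp add: i)+
      moreover have "s \<le> t" "t - s \<le> H"
        using subsetD[OF T'(2) that] by (simp_all add: i T_def)
      ultimately have "norm (young_defect X f Y s t) \<le> K H * (t - s) powr z"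
        unfolding P_def by (intro bound) (simp_all add: P_def)
      then show ?thesis by (simp add: i E_def)
    qed
    ultimately show ?thesis by blast
  qed
  have "?B \<inter> (\<Inter>i\<in>T. E i) \<noteq> {}"
    by (rule compact_imp_fip_image[OF compact_B closed_E fip])
  then obtain Y where Y: "Y \<in> ?B" "\<And>i. i \<in> T \<Longrightarrow> Y \<in> E i" by blast
  have "Y t0 \<in> cball w (R t0)" using Y(1) by auto
  \<comment> \<open>The ball at the initial time is a single point because \<open>0 powr \<gamma> = 0\<close>.\<close>
  then have "Y t0 = w" using \<gamma>_pos by (simp add: R_def split: if_splits)
  moreover have "young_solution z X f J Y"
  proof (rule ordered_imp_young_solution)
    show "\<exists>K\<ge>0. \<forall>s\<in>J. \<forall>t\<in>J. s \<le> t \<and> t - s \<le> H \<longrightarrow>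
        norm (young_defect X f Y s t) \<le> K * (t - s) powr z" for H
    proof (intro exI[of _ "K H"] conjI ballI impI)
      fix s t assume "s \<in> J" "t \<in> J" "s \<le> t \<and> t - s \<le> H"
      then have "Y \<in> E (H, s, t)" by (intro Y) (auto simp: T_def)
      then show "norm (young_defect X f Y s t) \<le> K H * (t - s) powr z" by (simp add: E_def)
    qed (rule K)
  qed simp
  ultimately show ?thesis by blast
qed

text \<open>Across \<open>t0\<close> the error is the sum of the errors on either side and of one splitting error, which is
controlled by the Hoelder bound for \<open>Y\<close> on the left.\<close>

lemma young_solution_glue:
  assumes "t0 \<in> J"
    and "young_solution z X f (J \<inter> {t0..}) Y" "young_solution z X f (J \<inter> {..t0}) Y"
  shows "young_solution z X f J Y"
proof (rule ordered_imp_young_solution)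
  fix H
  obtain K1 where K1: "0 \<le> K1" "\<And>s t. s \<in> J \<Longrightarrow> t0 \<le> s \<Longrightarrow> t \<in> J \<Longrightarrow> t0 \<le> t \<Longrightarrow> \<bar>t - s\<bar> \<le> H \<Longrightarrow>
      norm (young_defect X f Y s t) \<le> K1 * \<bar>t - s\<bar> powr z"
    using assms(2) unfolding young_solution_def by (metis IntI atLeast_iff)
  obtain K2 where K2: "0 \<le> K2" "\<And>s t. s \<in> J \<Longrightarrow> s \<le> t0 \<Longrightarrow> t \<in> J \<Longrightarrow> t \<le> t0 \<Longrightarrow> \<bar>t - s\<bar> \<le> H \<Longrightarrow>
      norm (young_defect X f Y s t) \<le> K2 * \<bar>t - s\<bar> powr z"
    using assms(3) unfolding young_solution_def by (metis IntI atMost_iff)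
  define B where "B = M * L + K2 * H powr (\<delta> * \<gamma>)"
  have B0: "0 \<le> B" using M_nonneg L_nonneg K2 by (simp add: B_def)
  define D where "D = C * L * (1 + B powr \<delta>)"
  have D0: "0 \<le> D" using C_nonneg L_nonneg by (simp add: D_def)
  have "norm (young_defect X f Y s t) \<le> (K1 + K2 + D) * (t - s) powr z"
    if st: "s \<in> J" "t \<in> J" "s \<le> t \<and> t - s \<le> H" for s t
  proof -
    have mono: "k * e powr z \<le> k * (t - s) powr z" if "0 \<le> k" "0 \<le> e" "e \<le> t - s" for k e
      using that young by (intro mult_left_mono powr_mono2) auto
    consider "t0 \<le> s" | "t \<le> t0" | "s \<le> t0" "t0 \<le> t" by linarith
    then have "norm (young_defect X f Y s t)
        \<le> K1 * (t - s) powr z + K2 * (t - s) powr z + D * (t - s) powr z"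
    proof cases
      case 1
      have "0 \<le> K2 * (t - s) powr z" "0 \<le> D * (t - s) powr z" using K2 D0 by auto
      then show ?thesis using K1(2)[of s t] 1 st by simp
    next
      case 2
      have "0 \<le> K1 * (t - s) powr z" "0 \<le> D * (t - s) powr z" using K1 D0 by auto
      then show ?thesis using K2(2)[of s t] 2 st by simp
    next
      case 3
      have left: "norm (young_defect X f Y s t0) \<le> K2 * \<bar>t0 - s\<bar> powr z"
        using K2(2)[of s t0] 3 st assms(1) by simp
      have right: "norm (young_defect X f Y t0 t) \<le> K1 * \<bar>t - t0\<bar> powr z"
        using K1(2)[of t0 t] 3 st assms(1) by simp
      have "norm (Y t0 - Y s) \<le> B * \<bar>t0 - s\<bar> powr \<gamma>"
        unfolding B_def using left K2 st 3 assms(1) by (intro increment_bound) auto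
      then have "norm (blinfun_apply (f t0 (Y t0) - f s (Y s)) (X t - X t0)) \<le> D * (t - s) powr z"
        unfolding D_def using B0 st 3 assms(1) by (intro splitting_error) auto
      moreover have "norm (young_defect X f Y s t) \<le> norm (young_defect X f Y s t0)
          + norm (young_defect X f Y t0 t)
          + norm (blinfun_apply (f t0 (Y t0) - f s (Y s)) (X t - X t0))"
        by (subst young_defect_split[of X f Y s t t0])
          (meson norm_triangle_le add_mono order_refl norm_triangle_ineq order_trans)
      ultimately show ?thesis
        using left right mono[of K2 "t0 - s"] mono[of K1 "t - t0"] K1 K2 3 by simp
    qed
    then show ?thesis by (simp add: algebra_simps)
  qed
  then show "\<exists>K\<ge>0. \<forall>s\<in>J. \<forall>t\<in>J. s \<le> t \<and> t - s \<le> H \<longrightarrow>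
      norm (young_defect X f Y s t) \<le> K * (t - s) powr z"
    using K1(1) K2(1) D0 by (intro exI[of _ "K1 + K2 + D"]) auto
qed simp

text \<open>Times before \<open>t0\<close> become times after \<open>- t0\<close> under \<open>t \<mapsto> - t\<close>. The reversed driver and field satisfy
the same bounds, and since \<open>young_solution\<close> controls the error for both orders of \<open>s\<close> and \<open>t\<close>, it
is preserved by the reversal.\<close>

theorem young_solution_exists:
  assumes t0: "t0 \<in> J"
  shows "\<exists>Y. Y t0 = w \<and> young_solution z X f J Y"
proof -
  interpret right: young_equation "J \<inter> {t0..}" X f \<gamma> \<delta> L C M
    using young_equation_axioms unfolding young_equation_def by auto
  interpret left: young_equation "{t. - t \<in> J \<and> - t0 \<le> t}" "\<lambda>t. X (- t)" "\<lambda>t. f (- t)" \<gamma> \<delta> L C M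
  proof
    fix s t assume st: "s \<in> {t. - t \<in> J \<and> - t0 \<le> t}" "t \<in> {t. - t \<in> J \<and> - t0 \<le> t}"
    have r: "\<bar>- t - - s\<bar> = \<bar>t - s\<bar>" by simp
    show "norm (X (- t) - X (- s)) \<le> L * \<bar>t - s\<bar> powr \<gamma>"
      using driver_holder[of "- s" "- t"] st unfolding r by auto
    show "norm (f (- t) w - f (- s) v) \<le> C * (\<bar>t - s\<bar> powr (\<delta> * \<gamma>) + norm (w - v) powr \<delta>)" for v w
      using field_holder[of "- s" "- t" w v] st unfolding r by auto
  qed (use \<gamma>_pos \<delta>_pos \<delta>_less young L_nonneg C_nonneg M_nonneg field_bounded in auto)
  obtain Y1 where Y1: "Y1 t0 = w" "young_solution z X f (J \<inter> {t0..}) Y1"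
    using right.solution_from_left_end[of t0 w] t0 by auto
  have "\<exists>Y. Y (- t0) = w \<and>
      young_solution z (\<lambda>t. X (- t)) (\<lambda>t. f (- t)) {t. - t \<in> J \<and> - t0 \<le> t} Y"
    by (rule left.solution_from_left_end) (use t0 in auto)
  then obtain Y2 where Y2: "Y2 (- t0) = w"
      "young_solution z (\<lambda>t. X (- t)) (\<lambda>t. f (- t)) {t. - t \<in> J \<and> - t0 \<le> t} Y2"
    by (elim exE conjE)
  define Y where "Y t = (if t0 \<le> t then Y1 t else Y2 (- t))" for t
  have Yl: "Y t = Y2 (- t)" if "t \<le> t0" for t using that Y1 Y2 by (auto simp: Y_def)
  have "young_solution z X f (J \<inter> {t0..}) Y"
    using Y1(2) by (auto simp: young_solution_def young_defect_def Y_def)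
  moreover have "young_solution z X f (J \<inter> {..t0}) Y"
    unfolding young_solution_def
  proof
    fix H
    obtain K where K: "0 \<le> K" "\<And>s t. - s \<in> J \<Longrightarrow> - t0 \<le> s \<Longrightarrow> - t \<in> J \<Longrightarrow> - t0 \<le> t \<Longrightarrow> \<bar>t - s\<bar> \<le> H \<Longrightarrow>
        norm (young_defect (\<lambda>t. X (- t)) (\<lambda>t. f (- t)) Y2 s t) \<le> K * \<bar>t - s\<bar> powr z"
      using Y2(2)[unfolded young_solution_def, rule_format, of H] by auto
    have "norm (young_defect X f Y s t) \<le> K * \<bar>t - s\<bar> powr z"
      if "s \<in> J" "s \<le> t0" "t \<in> J" "t \<le> t0" "\<bar>t - s\<bar> \<le> H" for s t
    proof -
      have "young_defect X f Y s t = young_defect (\<lambda>t. X (- t)) (\<lambda>t. f (- t)) Y2 (- s) (- t)"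
        using that by (simp add: young_defect_def Yl)
      moreover have "\<bar>- t - - s\<bar> = \<bar>t - s\<bar>" by simp
      ultimately show ?thesis using K(2)[of "- s" "- t"] that by auto
    qed
    then show "\<exists>K\<ge>0. \<forall>s\<in>J \<inter> {..t0}. \<forall>t\<in>J \<inter> {..t0}. \<bar>t - s\<bar> \<le> H \<longrightarrow>
        norm (young_defect X f Y s t) \<le> K * \<bar>t - s\<bar> powr z"
      using K(1) by (intro exI[of _ K]) auto
  qed
  ultimately have "young_solution z X f J Y" by (rule young_solution_glue[OF t0])
  moreover have "Y t0 = w" using Y1 by (simp add: Y_def)
  ultimately show ?thesis by blast
qed

lemma young_solution_holder:
  assumes "young_solution z X f J Y" "S \<subseteq> J" "bounded S"
  shows "\<exists>K\<ge>0. \<forall>s\<in>S. \<forall>t\<in>S. norm (young_defect X f Y s t) \<le> K * \<bar>t - s\<bar> powr z"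
    and "\<exists>B\<ge>0. \<forall>s\<in>S. \<forall>t\<in>S. norm (Y t - Y s) \<le> B * dist s t powr \<gamma>"
proof -
  obtain H where H: "\<And>s t. s \<in> S \<Longrightarrow> t \<in> S \<Longrightarrow> \<bar>t - s\<bar> \<le> H"
    using assms(3) unfolding bounded_two_points by (metis abs_minus_commute dist_real_def)
  obtain K where K: "0 \<le> K" "\<And>s t. s \<in> S \<Longrightarrow> t \<in> S \<Longrightarrow>
      norm (young_defect X f Y s t) \<le> K * \<bar>t - s\<bar> powr z"
    using assms(1,2) H unfolding young_solution_def by (metis subsetD)
  show "\<exists>K\<ge>0. \<forall>s\<in>S. \<forall>t\<in>S. norm (young_defect X f Y s t) \<le> K * \<bar>t - s\<bar> powr z"
    using K by blast
  have "norm (Y t - Y s) \<le> (M * L + K * H powr (\<delta> * \<gamma>)) * dist s t powr \<gamma>"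
    if "s \<in> S" "t \<in> S" for s t
    unfolding dist_real_def abs_minus_commute[of s t] using that H K assms(2)
    by (intro increment_bound) blast+
  moreover have "0 \<le> M * L + K * H powr (\<delta> * \<gamma>)" using M_nonneg L_nonneg K by simp
  ultimately show "\<exists>B\<ge>0. \<forall>s\<in>S. \<forall>t\<in>S. norm (Y t - Y s) \<le> B * dist s t powr \<gamma>" by blast
qed

end

section \<open>Hoelder spaces and remainders of order z\<close>

lemma holder_spaceD:
  assumes "f \<in> holder_space \<gamma> S"
  obtains L where "0 \<le> L" "\<And>s t. s \<in> S \<Longrightarrow> t \<in> S \<Longrightarrow> norm (f t - f s) \<le> L * dist s t powr \<gamma>"
proof -
  obtain L where L: "\<And>x. x \<in> {norm (f t - f s) / dist s t powr \<gamma> | s t. s \<in> S \<and> t \<in> S \<and> s \<noteq> t} \<Longrightarrow> x \<le> L"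
    using assms unfolding holder_space_def bdd_above_def by blast
  have "norm (f t - f s) \<le> max 0 L * dist s t powr \<gamma>" if "s \<in> S" "t \<in> S" for s t
  proof (cases "s = t")
    case False
    then have "norm (f t - f s) / dist s t powr \<gamma> \<le> L" using that by (intro L) blast
    also have "\<dots> \<le> max 0 L" by simp
    finally show ?thesis using False by (simp add: pos_divide_le_eq)
  qed simp
  then show ?thesis using that[of "max 0 L"] by auto
qed

lemma holder_spaceI:
  assumes "0 < \<gamma>" "0 \<le> L" "bounded S"
    and L: "\<And>s t. s \<in> S \<Longrightarrow> t \<in> S \<Longrightarrow> norm (f t - f s) \<le> L * dist s t powr \<gamma>"
  shows "f \<in> holder_space \<gamma> S"
proof -
  have "continuous_on S f"
    unfolding continuous_on_def
  proof
    fix s assume s: "s \<in> S"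
    have "((\<lambda>t. L * dist s t powr \<gamma>) \<longlongrightarrow> L * dist s s powr \<gamma>) (at s within S)"
      using assms(1) by (intro tendsto_intros) auto
    then have "((\<lambda>t. L * dist s t powr \<gamma>) \<longlongrightarrow> 0) (at s within S)" by simp
    moreover have "\<forall>\<^sub>F t in at s within S. norm (f t - f s) \<le> L * dist s t powr \<gamma>"
      using L s by (auto simp: eventually_at_filter)
    ultimately have "((\<lambda>t. f t - f s) \<longlongrightarrow> 0) (at s within S)"
      by (intro Lim_null_comparison[of "\<lambda>t. f t - f s"])
    then show "(f \<longlongrightarrow> f s) (at s within S)" by (simp add: LIM_zero_iff)
  qed
  moreover have "bounded (f ` S)"
  proof -
    obtain H where H: "\<And>s t. s \<in> S \<Longrightarrow> t \<in> S \<Longrightarrow> dist s t \<le> H"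
      using assms(3) unfolding bounded_two_points by blast
    have "dist (f s) (f t) \<le> L * H powr \<gamma>" if "s \<in> S" "t \<in> S" for s t
    proof -
      have "dist (f s) (f t) \<le> L * dist s t powr \<gamma>"
        using L[OF that] by (simp add: dist_norm norm_minus_commute)
      also have "\<dots> \<le> L * H powr \<gamma>"
        using H[OF that] assms by (intro mult_left_mono powr_mono2) auto
      finally show ?thesis .
    qed
    then show ?thesis unfolding bounded_two_points by (intro exI[of _ "L * H powr \<gamma>"]) auto
  qed
  moreover have "bdd_above {norm (f t - f s) / dist s t powr \<gamma> | s t. s \<in> S \<and> t \<in> S \<and> s \<noteq> t}"
    using L by (intro bdd_aboveI[of _ L]) (auto simp: divide_le_eq)
  ultimately show ?thesis by (simp add: holder_space_def)
qed

lemma OmegaC_expD: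
  assumes "R \<in> OmegaC_exp z I"
  obtains K where "0 \<le> K" "\<And>s t. s \<in> I \<Longrightarrow> t \<in> I \<Longrightarrow> \<bar>R (s, t)\<bar> \<le> K * \<bar>t - s\<bar> powr z"
proof -
  obtain K where K: "\<And>x. x \<in> {\<bar>R (s, t)\<bar> / \<bar>t - s\<bar> powr z | s t. s \<in> I \<and> t \<in> I \<and> s \<noteq> t} \<Longrightarrow> x \<le> K"
    using assms unfolding OmegaC_exp_def bdd_above_def by blast
  have "\<bar>R (s, t)\<bar> \<le> max 0 K * \<bar>t - s\<bar> powr z" if "s \<in> I" "t \<in> I" for s t
  proof (cases "s = t")
    case True
    then show ?thesis using assms that by (simp add: OmegaC_exp_def OmegaC_def)
  next
    case False
    then have "\<bar>R (s, t)\<bar> / \<bar>t - s\<bar> powr z \<le> K" using that by (intro K) blast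
    also have "\<dots> \<le> max 0 K" by simp
    finally show ?thesis using False by (simp add: pos_divide_le_eq)
  qed
  then show ?thesis using that[of "max 0 K"] by auto
qed

section \<open>Characterization of the Young integral\<close>

text \<open>Additivity makes \<open>D u t\<close> the increment of \<open>D s\<close> between \<open>u\<close> and \<open>t\<close>; being of order \<open>z > 1\<close>, it forces
the derivative of \<open>D s\<close> to vanish on the interval.\<close>

lemma additive_superlinear_eq_0:
  fixes D :: "real \<Rightarrow> real \<Rightarrow> real"
  assumes "is_interval I" "1 < z"
    and add: "\<And>s u t. s \<in> I \<Longrightarrow> u \<in> I \<Longrightarrow> t \<in> I \<Longrightarrow> D s t = D s u + D u t"
    and K: "\<And>s t. s \<in> I \<Longrightarrow> t \<in> I \<Longrightarrow> \<bar>D s t\<bar> \<le> K * \<bar>t - s\<bar> powr z"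
    and "s \<in> I" "t \<in> I"
  shows "D s t = 0"
proof -
  have "((\<lambda>t. D s t) has_field_derivative 0) (at u within I)" if u: "u \<in> I" for u
  proof -
    have "((\<lambda>t. K * \<bar>t - u\<bar> powr (z - 1)) \<longlongrightarrow> K * \<bar>u - u\<bar> powr (z - 1)) (at u within I)"
      using assms(2) by (intro tendsto_intros) auto
    then have "((\<lambda>t. K * \<bar>t - u\<bar> powr (z - 1)) \<longlongrightarrow> 0) (at u within I)" by simp
    moreover have "\<forall>\<^sub>F t in at u within I. norm ((D s t - D s u) / (t - u)) \<le> K * \<bar>t - u\<bar> powr (z - 1)"
      unfolding eventually_at_filter
    proof (intro always_eventually allI impI)
      fix t assume t: "t \<noteq> u" "t \<in> I"
      have "D s t - D s u = D u t" using add[of s u t] t u assms(5) by simp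
      then show "norm ((D s t - D s u) / (t - u)) \<le> K * \<bar>t - u\<bar> powr (z - 1)"
        using K[OF u t(2)] t by (simp add: powr_diff divide_right_mono)
    qed
    ultimately show ?thesis
      unfolding has_field_derivative_iff
      by (rule Lim_null_comparison[rotated])
  qed
  then obtain c where "\<And>u. u \<in> I \<Longrightarrow> D s u = c"
    using has_field_derivative_zero_constant[of I "\<lambda>t. D s t"] assms(1) is_interval_convex by blast
  moreover have "D s s = 0" using add[of s s s] assms(5) by simp
  ultimately show ?thesis using assms(5,6) by metis
qed

text \<open>These are the properties that single out the remainder, and they hold for it once it exists and is
unique. Existence: for a primitive \<open>W\<close>, that is a solution for the field \<open>f s w = F s\<close>, the error with
the opposite sign is a remainder, as increments of \<open>W\<close> are annihilated by \<open>N_op\<close>. Uniqueness: two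
remainders differ by an additive function of order \<open>z > 1\<close>.\<close>

lemma Lambda_N_props:
  assumes I: "is_interval I" "bounded I"
    and \<gamma>: "0 < \<gamma>" and \<delta>: "0 < \<delta>" "\<delta> < 1" "1 < \<delta> * \<gamma> + \<gamma>"
    and F: "F \<in> holder_space (\<delta> * \<gamma>) I" and G: "G \<in> holder_space \<gamma> I"
  defines "A \<equiv> path_incr F G"
  defines "R \<equiv> Lambda_N (\<delta> * \<gamma> + \<gamma>) I A"
  shows "R \<in> OmegaC_exp (\<delta> * \<gamma> + \<gamma>) I"
    and "\<And>s u t. s \<in> I \<Longrightarrow> u \<in> I \<Longrightarrow> t \<in> I \<Longrightarrow> N_op R s u t = N_op A s u t"
proof -
  let ?z = "\<delta> * \<gamma> + \<gamma>"
  let ?P = "\<lambda>R. R \<in> OmegaC_exp ?z I \<and> R \<in> extensional (I \<times> I) \<and>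
             (\<forall>s\<in>I. \<forall>u\<in>I. \<forall>t\<in>I. N_op R s u t = N_op A s u t)"
  have "\<exists>R. ?P R"
  proof (cases "I = {}")
    case True
    then show ?thesis
      by (intro exI[of _ "\<lambda>_. undefined"]) (auto simp: OmegaC_exp_def OmegaC_def)
  next
    case False
    then obtain t0 where t0: "t0 \<in> I" by blast
    obtain C where C: "0 \<le> C" "\<And>s t. s \<in> I \<Longrightarrow> t \<in> I \<Longrightarrow> norm (F t - F s) \<le> C * dist s t powr (\<delta> * \<gamma>)"
      using holder_spaceD[OF F] by blast
    obtain L where L: "0 \<le> L" "\<And>s t. s \<in> I \<Longrightarrow> t \<in> I \<Longrightarrow> norm (G t - G s) \<le> L * dist s t powr \<gamma>"
      using holder_spaceD[OF G] by blast
    obtain M where M: "0 \<le> M" "\<And>s. s \<in> I \<Longrightarrow> norm (F s) \<le> M"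
      using F unfolding holder_space_def bounded_pos by (auto intro: less_imp_le)
    let ?f = "\<lambda>s (_::real). F s *\<^sub>R (id_blinfun :: real \<Rightarrow>\<^sub>L real)"
    interpret young_equation I G ?f \<gamma> \<delta> L C M
    proof
      show "norm (?f t w - ?f s v) \<le> C * (\<bar>t - s\<bar> powr (\<delta> * \<gamma>) + norm (w - v) powr \<delta>)"
        if "s \<in> I" "t \<in> I" for s t v w
      proof -
        have "norm (?f t w - ?f s v) = norm (F t - F s)"
          by (simp flip: scaleR_diff_left)
        also have "\<dots> \<le> C * \<bar>t - s\<bar> powr (\<delta> * \<gamma>)"
          using C(2)[OF that] by (simp add: dist_real_def abs_minus_commute)
        also have "\<dots> \<le> C * (\<bar>t - s\<bar> powr (\<delta> * \<gamma>) + norm (w - v) powr \<delta>)"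
          using C(1) by (intro mult_left_mono) auto
        finally show ?thesis .
      qed
    qed (use assms L C M in \<open>auto simp: dist_real_def abs_minus_commute\<close>)
    obtain W where W: "young_solution ?z G ?f I W"
      using young_solution_exists[OF t0] by blast
    obtain K where K: "0 \<le> K"
        "\<And>s t. s \<in> I \<Longrightarrow> t \<in> I \<Longrightarrow> norm (young_defect G ?f W s t) \<le> K * \<bar>t - s\<bar> powr ?z"
      using young_solution_holder(1)[OF W order_refl I(2)] by blast
    obtain B where "0 \<le> B" "\<And>s t. s \<in> I \<Longrightarrow> t \<in> I \<Longrightarrow> norm (W t - W s) \<le> B * dist s t powr \<gamma>"
      using young_solution_holder(2)[OF W order_refl I(2)] by blast
    then have W': "W \<in> holder_space \<gamma> I" using I \<gamma> by (intro holder_spaceI)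
    define R0 where "R0 = (\<lambda>(s, t). F s * (G t - G s) - (W t - W s))"
    have R0_bound: "\<bar>R0 (s, t)\<bar> \<le> K * \<bar>t - s\<bar> powr ?z" if "s \<in> I" "t \<in> I" for s t
      using K(2)[OF that] by (simp add: R0_def young_defect_def blinfun.scaleR_left)
    have cont_fst: "continuous_on (I \<times> I) (\<lambda>x. h (fst x))" if "continuous_on I h" for h :: "real \<Rightarrow> real"
      by (rule continuous_on_compose2[OF that]) (auto intro: continuous_intros)
    have cont_snd: "continuous_on (I \<times> I) (\<lambda>x. h (snd x))" if "continuous_on I h" for h :: "real \<Rightarrow> real"
      by (rule continuous_on_compose2[OF that]) (auto intro: continuous_intros)
    have R0_cont: "continuous_on (I \<times> I) R0"
      unfolding R0_def case_prod_unfold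
      using F G W' by (intro continuous_intros cont_fst cont_snd) (auto simp: holder_space_def)
    have R0_bdd: "bounded (R0 ` (I \<times> I))"
    proof -
      obtain H where H: "\<And>s t. s \<in> I \<Longrightarrow> t \<in> I \<Longrightarrow> \<bar>t - s\<bar> \<le> H"
        using I(2) unfolding bounded_two_points by (metis abs_minus_commute dist_real_def)
      have "\<bar>R0 (s, t)\<bar> \<le> K * H powr ?z" if "s \<in> I" "t \<in> I" for s t
        using R0_bound[OF that] H[OF that] K(1) \<delta>(3)
        by (smt (verit) abs_ge_zero mult_left_mono powr_mono2)
      then show ?thesis unfolding bounded_iff by auto
    qed
    \<comment> \<open>The remainder is required to be \<open>undefined\<close> outside \<open>I \<times> I\<close>.\<close>
    define R1 where "R1 = restrict R0 (I \<times> I)"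
    have "R1 \<in> OmegaC I"
      using R0_cont R0_bdd unfolding OmegaC_def R1_def
      by (auto simp: R0_def cong: continuous_on_cong image_cong)
    moreover have "bdd_above {\<bar>R1 (s, t)\<bar> / \<bar>t - s\<bar> powr ?z | s t. s \<in> I \<and> t \<in> I \<and> s \<noteq> t}"
      using R0_bound by (intro bdd_aboveI[of _ K]) (auto simp: R1_def divide_le_eq)
    moreover have "N_op R1 s u t = N_op A s u t" if "s \<in> I" "u \<in> I" "t \<in> I" for s u t
      using that by (simp add: N_op_def A_def path_incr_def R1_def R0_def)
    ultimately have "?P R1" by (auto simp: OmegaC_exp_def R1_def)
    then show ?thesis by blast
  qed
  moreover have "R1 = R2" if R: "?P R1" "?P R2" for R1 R2
  proof (rule extensionalityI)
    obtain K1 where K1: "\<And>s t. s \<in> I \<Longrightarrow> t \<in> I \<Longrightarrow> \<bar>R1 (s, t)\<bar> \<le> K1 * \<bar>t - s\<bar> powr ?z"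
      by (rule OmegaC_expD[of R1 ?z I]) (use R in auto)
    obtain K2 where K2: "\<And>s t. s \<in> I \<Longrightarrow> t \<in> I \<Longrightarrow> \<bar>R2 (s, t)\<bar> \<le> K2 * \<bar>t - s\<bar> powr ?z"
      by (rule OmegaC_expD[of R2 ?z I]) (use R in auto)
    fix x assume "x \<in> I \<times> I"
    then obtain s t where x: "x = (s, t)" "s \<in> I" "t \<in> I" by blast
    have "R1 (s, t) - R2 (s, t) = 0"
    proof (rule additive_superlinear_eq_0[where D = "\<lambda>s t. R1 (s, t) - R2 (s, t)" and K = "K1 + K2", OF I(1) \<delta>(3) _ _ x(2,3)])
      fix s u t assume sut: "s \<in> I" "u \<in> I" "t \<in> I"
      have "N_op R1 s u t = N_op R2 s u t" using R sut by simp
      then show "R1 (s, t) - R2 (s, t) = (R1 (s, u) - R2 (s, u)) + (R1 (u, t) - R2 (u, t))"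
        by (simp add: N_op_def)
    next
      fix s t assume "s \<in> I" "t \<in> I"
      then show "\<bar>R1 (s, t) - R2 (s, t)\<bar> \<le> (K1 + K2) * \<bar>t - s\<bar> powr ?z"
        using K1[of s t] K2[of s t] by (simp add: algebra_simps)
    qed
    then show "R1 x = R2 x" by (simp add: x)
  qed (use R in auto)
  ultimately have "\<exists>!R. ?P R" by blast
  then have "?P R" unfolding R_def Lambda_N_def by (rule theI')
  then show "R \<in> OmegaC_exp (\<delta> * \<gamma> + \<gamma>) I"
    and "\<And>s u t. s \<in> I \<Longrightarrow> u \<in> I \<Longrightarrow> t \<in> I \<Longrightarrow> N_op R s u t = N_op A s u t" by auto
qed

text \<open>A finite sum of Young integrals is the increment of any function \<open>h\<close> whose increments agree with the
Riemann summands up to order \<open>z > 1\<close>. The sum of integrals is itself additive with such an expansion,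
so its difference from the increment of \<open>h\<close> vanishes. Several integrals have to be summed at once,
because for a system only their sum is known to be close to an increment of the solution.\<close>

lemma young_integral_eqI:
  fixes F G :: "'i \<Rightarrow> real \<Rightarrow> real"
  assumes I: "is_interval I" "bounded I"
    and \<gamma>: "0 < \<gamma>" and \<delta>: "0 < \<delta>" "\<delta> < 1" "1 < \<delta> * \<gamma> + \<gamma>"
    and fin: "finite N"
    and F: "\<And>\<nu>. \<nu> \<in> N \<Longrightarrow> F \<nu> \<in> holder_space (\<delta> * \<gamma>) I"
    and G: "\<And>\<nu>. \<nu> \<in> N \<Longrightarrow> G \<nu> \<in> holder_space \<gamma> I"
    and K: "\<And>s t. s \<in> I \<Longrightarrow> t \<in> I \<Longrightarrow>
      \<bar>h t - h s - (\<Sum>\<nu>\<in>N. F \<nu> s * (G \<nu> t - G \<nu> s))\<bar> \<le> K * \<bar>t - s\<bar> powr (\<delta> * \<gamma> + \<gamma>)"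
    and st: "s \<in> I" "t \<in> I"
  shows "(\<Sum>\<nu>\<in>N. young_integral (\<delta> * \<gamma>) \<gamma> I (F \<nu>) (G \<nu>) s t) = h t - h s"
proof -
  let ?z = "\<delta> * \<gamma> + \<gamma>"
  define R where "R \<nu> = Lambda_N ?z I (path_incr (F \<nu>) (G \<nu>))" for \<nu>
  have "\<exists>k. \<forall>s\<in>I. \<forall>t\<in>I. \<bar>R \<nu> (s, t)\<bar> \<le> k * \<bar>t - s\<bar> powr ?z" if "\<nu> \<in> N" for \<nu>
    using OmegaC_expD[OF Lambda_N_props(1)[OF I \<gamma> \<delta> F[OF that] G[OF that]]]
    unfolding R_def by metis
  then obtain k where k: "\<And>\<nu> s t. \<nu> \<in> N \<Longrightarrow> s \<in> I \<Longrightarrow> t \<in> I \<Longrightarrow> \<bar>R \<nu> (s, t)\<bar> \<le> k \<nu> * \<bar>t - s\<bar> powr ?z"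
    by metis
  define j where "j s t = (\<Sum>\<nu>\<in>N. young_integral (\<delta> * \<gamma>) \<gamma> I (F \<nu>) (G \<nu>) s t)" for s t
  have j: "j s t = (\<Sum>\<nu>\<in>N. F \<nu> s * (G \<nu> t - G \<nu> s)) - (\<Sum>\<nu>\<in>N. R \<nu> (s, t))" for s t
    by (simp add: j_def young_integral_def R_def path_incr_def sum_subtractf)
  have "j s t - (h t - h s) = 0"
  proof (rule additive_superlinear_eq_0[where D = "\<lambda>s t. j s t - (h t - h s)" and K = "sum k N + K", OF I(1) \<delta>(3) _ _ st])
    fix s u t assume sut: "s \<in> I" "u \<in> I" "t \<in> I"
    have "j s t = j s u + j u t"
      unfolding j_def sum.distrib[symmetric]
    proof (rule sum.cong)
      fix \<nu> assume "\<nu> \<in> N"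
      then show "young_integral (\<delta> * \<gamma>) \<gamma> I (F \<nu>) (G \<nu>) s t =
          young_integral (\<delta> * \<gamma>) \<gamma> I (F \<nu>) (G \<nu>) s u + young_integral (\<delta> * \<gamma>) \<gamma> I (F \<nu>) (G \<nu>) u t"
        using Lambda_N_props(2)[OF I \<gamma> \<delta> F G sut, of \<nu> \<nu>]
        by (simp add: young_integral_def N_op_def)
    qed simp
    then show "j s t - (h t - h s) = (j s u - (h u - h s)) + (j u t - (h t - h u))" by simp
  next
    fix s t assume st: "s \<in> I" "t \<in> I"
    have "\<bar>\<Sum>\<nu>\<in>N. R \<nu> (s, t)\<bar> \<le> (\<Sum>\<nu>\<in>N. k \<nu> * \<bar>t - s\<bar> powr ?z)"
      using k st by (intro order_trans[OF sum_abs] sum_mono) auto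
    then show "\<bar>j s t - (h t - h s)\<bar> \<le> (sum k N + K) * \<bar>t - s\<bar> powr ?z"
      using K[OF st] unfolding j by (simp add: distrib_right sum_distrib_right)
  qed
  then show ?thesis by (simp add: j_def)
qed

section \<open>Existence of solutions of Young differential equations\<close>

theorem proposition5:
  fixes J :: "real set" and t0 \<gamma> \<delta> :: real
    and y :: "'v::euclidean_space" and X :: "real \<Rightarrow> 'v"
    and \<phi> :: "'v \<Rightarrow> ('v \<Rightarrow>\<^sub>L 'v)"
  assumes "is_interval J" and "t0 \<in> J"
    and "X \<in> holder_space \<gamma> J"
    and "\<gamma> > 1 / 2"
    and "\<phi> \<in> holder_space \<delta> UNIV"
    and "0 < \<delta>" and "\<delta> < 1" and "(1 + \<delta>) * \<gamma> > 1"
  shows "\<exists>Y :: real \<Rightarrow> 'v. \<forall>I. is_interval I \<and> bounded I \<and> I \<subseteq> J \<and> t0 \<in> I \<longrightarrow>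
           Y \<in> holder_space \<gamma> I \<and>
           (\<forall>t\<in>I. \<forall>\<mu>\<in>Basis.
              Y t \<bullet> \<mu> = y \<bullet> \<mu> +
                (\<Sum>\<nu>\<in>Basis. young_integral (\<delta> * \<gamma>) \<gamma> I
                   (\<lambda>u. blinfun_apply (\<phi> (Y u)) \<nu> \<bullet> \<mu>) (\<lambda>u. X u \<bullet> \<nu>) t0 t))"
proof -
  have \<gamma>: "0 < \<gamma>" and z_gt_1: "1 < \<delta> * \<gamma> + \<gamma>" using assms by (auto simp: algebra_simps)
  obtain L where L: "0 \<le> L" "\<And>s t. s \<in> J \<Longrightarrow> t \<in> J \<Longrightarrow> norm (X t - X s) \<le> L * dist s t powr \<gamma>"
    using holder_spaceD[OF assms(3)] by blast
  obtain C where C: "0 \<le> C" "\<And>v w. norm (\<phi> w - \<phi> v) \<le> C * dist v w powr \<delta>"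
    using holder_spaceD[OF assms(5)] by (metis UNIV_I)
  obtain M where M: "0 \<le> M" "\<And>w. norm (\<phi> w) \<le> M"
    using assms(5) unfolding holder_space_def bounded_pos by (auto intro: less_imp_le)
  interpret young_equation J X "\<lambda>_. \<phi>" \<gamma> \<delta> L C M
  proof
    show "norm (\<phi> w - \<phi> v) \<le> C * (\<bar>t - s\<bar> powr (\<delta> * \<gamma>) + norm (w - v) powr \<delta>)" for s t v w
    proof -
      have "norm (\<phi> w - \<phi> v) \<le> C * norm (w - v) powr \<delta>"
        using C(2)[of w v] by (simp add: dist_norm norm_minus_commute)
      also have "\<dots> \<le> C * (\<bar>t - s\<bar> powr (\<delta> * \<gamma>) + norm (w - v) powr \<delta>)"
        using C(1) by (intro mult_left_mono) auto
      finally show ?thesis .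
    qed
  qed (use assms \<gamma> z_gt_1 L C M in \<open>auto simp: dist_real_def abs_minus_commute\<close>)
  obtain Y where Y: "Y t0 = y" "young_solution z X (\<lambda>_. \<phi>) J Y"
    using young_solution_exists[OF assms(2)] by blast
  have "Y \<in> holder_space \<gamma> I \<and>
           (\<forall>t\<in>I. \<forall>\<mu>\<in>Basis.
              Y t \<bullet> \<mu> = y \<bullet> \<mu> +
                (\<Sum>\<nu>\<in>Basis. young_integral (\<delta> * \<gamma>) \<gamma> I
                   (\<lambda>u. blinfun_apply (\<phi> (Y u)) \<nu> \<bullet> \<mu>) (\<lambda>u. X u \<bullet> \<nu>) t0 t))"
    if I: "is_interval I" "bounded I" "I \<subseteq> J" "t0 \<in> I" for I
  proof (intro conjI ballI)
    obtain K where K: "0 \<le> K"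
        "\<And>s t. s \<in> I \<Longrightarrow> t \<in> I \<Longrightarrow> norm (young_defect X (\<lambda>_. \<phi>) Y s t) \<le> K * \<bar>t - s\<bar> powr z"
      using young_solution_holder(1)[OF Y(2) I(3,2)] by blast
    obtain B where B: "0 \<le> B" "\<And>s t. s \<in> I \<Longrightarrow> t \<in> I \<Longrightarrow> norm (Y t - Y s) \<le> B * dist s t powr \<gamma>"
      using young_solution_holder(2)[OF Y(2) I(3,2)] by blast
    show "Y \<in> holder_space \<gamma> I" using holder_spaceI[OF \<gamma> B(1) I(2) B(2)] .
    fix t and \<mu> :: 'v assume t: "t \<in> I" and \<mu>: "\<mu> \<in> Basis"
    have "(\<Sum>\<nu>\<in>Basis. young_integral (\<delta> * \<gamma>) \<gamma> I
            (\<lambda>u. blinfun_apply (\<phi> (Y u)) \<nu> \<bullet> \<mu>) (\<lambda>u. X u \<bullet> \<nu>) t0 t) = Y t \<bullet> \<mu> - Y t0 \<bullet> \<mu>"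
    proof (rule young_integral_eqI[OF I(1,2) \<gamma> assms(6,7) z_gt_1 finite_Basis, where K = K])
      fix \<nu> :: 'v assume \<nu>: "\<nu> \<in> Basis"
      show "(\<lambda>u. blinfun_apply (\<phi> (Y u)) \<nu> \<bullet> \<mu>) \<in> holder_space (\<delta> * \<gamma>) I"
      proof (rule holder_spaceI)
        fix s t assume st: "s \<in> I" "t \<in> I"
        have "norm (blinfun_apply (\<phi> (Y t)) \<nu> \<bullet> \<mu> - blinfun_apply (\<phi> (Y s)) \<nu> \<bullet> \<mu>)
            = \<bar>blinfun_apply (\<phi> (Y t) - \<phi> (Y s)) \<nu> \<bullet> \<mu>\<bar>"
          by (simp add: blinfun.diff_left inner_diff_left)
        also have "\<dots> \<le> norm (blinfun_apply (\<phi> (Y t) - \<phi> (Y s)) \<nu>)"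
          using \<mu> by (rule Basis_le_norm)
        also have "\<dots> \<le> norm (\<phi> (Y t) - \<phi> (Y s))"
          using norm_blinfun[of "\<phi> (Y t) - \<phi> (Y s)" \<nu>] \<nu> by simp
        also have "\<dots> \<le> C * norm (Y t - Y s) powr \<delta>"
          using C(2)[of "Y t" "Y s"] by (simp add: dist_norm norm_minus_commute)
        also have "\<dots> \<le> C * (B * dist s t powr \<gamma>) powr \<delta>"
          using B(2)[OF st] C(1) assms(6) by (intro mult_left_mono powr_mono2) auto
        also have "\<dots> = C * B powr \<delta> * dist s t powr (\<delta> * \<gamma>)"
          using B(1) by (simp add: powr_mult powr_powr mult.commute)
        finally show "norm (blinfun_apply (\<phi> (Y t)) \<nu> \<bullet> \<mu> - blinfun_apply (\<phi> (Y s)) \<nu> \<bullet> \<mu>)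
            \<le> C * B powr \<delta> * dist s t powr (\<delta> * \<gamma>)" .
      qed (use \<gamma> assms(6) C(1) I(2) in auto)
      show "(\<lambda>u. X u \<bullet> \<nu>) \<in> holder_space \<gamma> I"
      proof (rule holder_spaceI[OF \<gamma> L(1) I(2)])
        fix s t assume "s \<in> I" "t \<in> I"
        then have "norm (X t - X s) \<le> L * dist s t powr \<gamma>" using L(2) I(3) by blast
        then show "norm (X t \<bullet> \<nu> - X s \<bullet> \<nu>) \<le> L * dist s t powr \<gamma>"
          using Basis_le_norm[OF \<nu>, of "X t - X s"] by (simp add: inner_diff_left)
      qed
    next
      fix s t assume st: "s \<in> I" "t \<in> I"
      \<comment> \<open>In coordinates the Euler increment is the sum of the Riemann summands.\<close>
      have "blinfun_apply (\<phi> (Y s)) (X t - X s)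
          = (\<Sum>\<nu>\<in>Basis. ((X t - X s) \<bullet> \<nu>) *\<^sub>R blinfun_apply (\<phi> (Y s)) \<nu>)"
        by (subst (1) euclidean_representation[symmetric, of "X t - X s"])
          (simp only: blinfun.sum_right blinfun.scaleR_right)
      then have "blinfun_apply (\<phi> (Y s)) (X t - X s) \<bullet> \<mu>
          = (\<Sum>\<nu>\<in>Basis. (blinfun_apply (\<phi> (Y s)) \<nu> \<bullet> \<mu>) * (X t \<bullet> \<nu> - X s \<bullet> \<nu>))"
        by (simp add: inner_sum_left inner_diff_left mult.commute)
      then have "Y t \<bullet> \<mu> - Y s \<bullet> \<mu>
            - (\<Sum>\<nu>\<in>Basis. (blinfun_apply (\<phi> (Y s)) \<nu> \<bullet> \<mu>) * (X t \<bullet> \<nu> - X s \<bullet> \<nu>))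
          = young_defect X (\<lambda>_. \<phi>) Y s t \<bullet> \<mu>"
        by (simp add: young_defect_def inner_diff_left)
      then show "\<bar>Y t \<bullet> \<mu> - Y s \<bullet> \<mu>
            - (\<Sum>\<nu>\<in>Basis. (blinfun_apply (\<phi> (Y s)) \<nu> \<bullet> \<mu>) * (X t \<bullet> \<nu> - X s \<bullet> \<nu>))\<bar>
          \<le> K * \<bar>t - s\<bar> powr (\<delta> * \<gamma> + \<gamma>)"
        using Basis_le_norm[OF \<mu>] K(2)[OF st] by (metis order_trans)
    qed (use I t in auto)
    then show "Y t \<bullet> \<mu> = y \<bullet> \<mu> +
                (\<Sum>\<nu>\<in>Basis. young_integral (\<delta> * \<gamma>) \<gamma> I
                   (\<lambda>u. blinfun_apply (\<phi> (Y u)) \<nu> \<bullet> \<mu>) (\<lambda>u. X u \<bullet> \<nu>) t0 t)"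
      using Y(1) by simp
  qed
  then show ?thesis by blast
qed

end
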